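(* The multivariate generating function for Dyck paths according to the numbers of centered, left and right tunnels, the number of centered multitunnels, and semilength is $$\sum_{D\in\mathcal{D}} x^{\mathrm{ct}(D)} u^{\mathrm{lt}(D)} v^{\mathrm{rt}(D)} w^{\mathrm{cmt}(D)} z^{|D|}=\frac{2}{2-w+(v+u-2x)wz+w\sqrt{1-2(v+u)z+(v-u)^2 z^2}}.$$
   Context: A Dyck path of length $2n$ is a lattice path from $(0,0)$ to $(2n,0)$ consisting of up-steps $\mathbf{u}=(1,1)$ and down-steps $\mathbf{d}=(1,-1)$ that never goes below the $x$-axis; it is identified with its word in the letters $\mathbf{u},\mathbf{d}$ (bold letters are steps; $u$, $v$, etc. are formal variables). $\mathcal{D}_n$ is the set of Dyck paths of length $2n$, $\mathcal{D}=\bigcup_{n\ge0}\mathcal{D}_n$, and $|D|=n$ (semilength) for $D\in\mathcal{D}_n$. A tunnel of $D$ is a decomposition $D=A\mathbf{u}B\mathbf{d}C$ with $B$ a (possibly empty) Dyck path. It is centered, right, or left according to whether the length of $A$ is equal to, strictly greater than, or strictly less than the length of $C$. $\mathrm{ct}(D),\mathrm{rt}(D),\mathrm{lt}(D)$ are the numbers of centered, right and left tunnels of $D$. A centered multitunnel of $D$ is a decomposition $D=ABC$ with $B$ a nonempty Dyck path and $A$, $C$ of the same length; $\mathrm{cmt}(D)$ is the number of these. The identity is one of formal power series in $z$; the square root is the power series with constant term $1$. *)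

theory Defs
  imports "HOL-Analysis.Analysis" "HOL-Computational_Algebra.Fraction_Field"
begin

datatype step = Up | Down

fun step_height :: "step \<Rightarrow> int" where
  "step_height Up = 1"
| "step_height Down = -1"

definition height :: "step list \<Rightarrow> int" where
  "height P = sum_list (map step_height P)"

text \<open>
  The path with word \<open>P\<close> visits the points \<open>(k, height (take k P))\<close> for \<open>k \<le> length P\<close>.
\<close>

definition dyck_path :: "step list \<Rightarrow> bool" where
  "dyck_path P \<longleftrightarrow> height P = 0 \<and> (\<forall>k\<le>length P. height (take k P) \<ge> 0)"

definition semilength :: "step list \<Rightarrow> nat" where
  "semilength P = length P div 2"

text \<open>
  The triple \<open>(A, B, C)\<close> stands for the decomposition \<open>A u B d C\<close>.
\<close>

definition tunnels :: "step list \<Rightarrow> (step list \<times> step list \<times> step list) set" where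
  "tunnels P = {(A, B, C). P = A @ [Up] @ B @ [Down] @ C \<and> dyck_path B}"

definition ct :: "step list \<Rightarrow> nat" where
  "ct P = card {(A, B, C) \<in> tunnels P. length A = length C}"

definition rt :: "step list \<Rightarrow> nat" where
  "rt P = card {(A, B, C) \<in> tunnels P. length A > length C}"

definition lt :: "step list \<Rightarrow> nat" where
  "lt P = card {(A, B, C) \<in> tunnels P. length A < length C}"

definition cmt :: "step list \<Rightarrow> nat" where
  "cmt P = card {(A, B, C). P = A @ B @ C \<and> dyck_path B \<and> B \<noteq> [] \<and> length A = length C}"

text \<open>
  In \<^term>\<open>fps_radical r k f\<close> the function \<open>r\<close> prescribes the root of the constant term.
  Prescribing \<open>1\<close> gives, for \<open>f\<close> with constant term \<open>1\<close>, the square root with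
  constant term \<open>1\<close>.
\<close>

definition fps_sqrt :: "'a::field_char_0 fps \<Rightarrow> 'a fps" where
  "fps_sqrt f = fps_radical (\<lambda>_ _. 1) 2 f"

lemma fps_sqrt_nth_0: "fps_nth (fps_sqrt f) 0 = 1"
  by (simp add: fps_sqrt_def)

lemma fps_sqrt_power2: "fps_nth f 0 = 1 \<Longrightarrow> fps_sqrt f ^ 2 = f"
  using power_radical[of f "\<lambda>_ _. 1" 1] by (simp add: fps_sqrt_def numeral_2_eq_2)

text \<open>
  The sum of the generating function is taken with respect to the metric of
  \<^typ>\<open>'a fps\<close>, the coefficientwise (\<open>z\<close>-adic) one. The variables other than \<open>z\<close> range over
  all elements of all fields of characteristic \<open>0\<close>. This includes the formal variables, for
  instance as the four indeterminates in \<^typ>\<open>rat poly poly poly poly fract\<close>.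
\<close>

end

theory Submission
  imports Defs
begin

text \<open>
  The idea is to peel the steps off a Dyck path in the order first, last, second, last but one,
  and so on, so that all factors that occur are centered, or off the center by one half step.

  Deleting adjacent pairs \<open>u d\<close> as long as possible turns every word \<open>M\<close> into a word
  \<open>d\<^sup>p u\<^sup>q\<close>; here \<open>p\<close> and \<open>q\<close> are the numbers of down-steps and of up-steps of \<open>M\<close>
  that are on no tunnel of \<open>M\<close>.
  Tunnels make sense for arbitrary words, so one can sum the weights
  \<open>x\<^sup>c\<^sup>t u\<^sup>l\<^sup>t v\<^sup>r\<^sup>t w\<^sup>c\<^sup>m\<^sup>t\<close> of all words of a given length with given \<open>(p, q)\<close>. When the first step is
  removed from a word, the only tunnel that can disappear is the one that begins with this step. It
  is a left one, unless it spans the whole word. The next step is removed at the right end, and the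
  tunnel that disappears then is a right one. So the sums obey a linear recursion. Which pairs \<open>(p, q)\<close> can
  follow depends on whether \<open>p\<close> or \<open>q\<close> is \<open>0\<close>, but as long as \<open>p + q > 0\<close> there is exactly one
  that lowers \<open>p + q\<close> by one and one that raises it by one, with factors that depend on nothing else
  (\<open>total_first_step_Suc\<close>, \<open>total_first_step_0\<close>, \<open>total_last_step_Suc\<close>, \<open>total_last_step_0\<close>).
  Hence the sums depend on \<open>p + q\<close> alone. This is the
  counterpart, on the level of sums, of the bijection of Elizalde and Deutsch, under which \<open>p + q\<close> becomes
  the height of the image path, centered tunnels and multitunnels become hills and returns to the axis,
  and left and right tunnels become the remaining up-steps at odd and at even positions.

  The level \<open>p + q = 0\<close> consists of Dyck paths. Each such factor is a centered multitunnel, which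
  gives \<open>w\<close>. If the next smaller centered factor is again a Dyck path, then the two steps removed
  form a centered tunnel, which gives \<open>x\<close>; if not, then they lie on a left and on a right tunnel,
  which gives \<open>u v\<close> (\<open>total_dyck\<close>).

  A recursion of this kind is solved by geometric progressions in \<open>p + q\<close>: with
  \<open>a = 1 + v z a b\<close> and \<open>b = 1 + u z a b\<close> the sums at level \<open>2 j\<close> have the generating function
  \<open>R (z a b)\<^sup>j\<close>, where \<open>R\<close> is the series sought, and \<open>total_dyck\<close> becomes
  \<open>R = 1 + w z (x + u v z a b) R\<close> (\<open>total_eq_coefficients\<close>). The quadratic equations for \<open>a\<close> and
  \<open>b\<close> bring in the square root (\<open>closed_form_solves_equations\<close>).
\<close>

section \<open>Unmatched steps of a word\<close>

text \<open>
  The numbers \<open>p\<close> and \<open>q\<close> such that the word reduces to \<open>d\<^sup>p u\<^sup>q\<close> by cancelling factors \<open>u d\<close>. The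
  truncated subtraction says that an up-step in front of a word without unmatched down-steps leaves
  their number at \<open>0\<close>.
\<close>

fun free_downs :: "step list \<Rightarrow> nat" where
  "free_downs [] = 0"
| "free_downs (Up # M) = free_downs M - 1"
| "free_downs (Down # M) = Suc (free_downs M)"

fun free_ups :: "step list \<Rightarrow> nat" where
  "free_ups [] = 0"
| "free_ups (Up # M) = (if free_downs M = 0 then Suc (free_ups M) else free_ups M)"
| "free_ups (Down # M) = free_ups M"

text \<open>
  Concatenation cancels the unmatched up-steps of \<open>M\<close> against the unmatched down-steps of \<open>N\<close>: this
  is the multiplication of the bicyclic monoid.
\<close>

lemma free_append:
  shows free_downs_append: "free_downs (M @ N) = free_downs M + (free_downs N - free_ups M)"
    and free_ups_append: "free_ups (M @ N) = free_ups N + (free_ups M - free_downs N)"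
proof -
  have "free_downs (M @ N) = free_downs M + (free_downs N - free_ups M) \<and>
    free_ups (M @ N) = free_ups N + (free_ups M - free_downs N)"
    by (induction M rule: free_downs.induct) auto
  then show "free_downs (M @ N) = free_downs M + (free_downs N - free_ups M)"
    and "free_ups (M @ N) = free_ups N + (free_ups M - free_downs N)" by auto
qed

lemma height_eq: "height M = int (free_ups M) - int (free_downs M)"
  by (induction M rule: free_downs.induct) (auto simp: height_def)

text \<open>
  The number of unmatched down-steps is the depth of the lowest point of the path below its
  starting point. The bound \<open>c\<close> is variable because it moves with the starting point when the
  first step is split off.
\<close>

lemma free_downs_le_iff:
  "(\<forall>k\<le>length M. height (take k M) \<ge> - int c) \<longleftrightarrow> free_downs M \<le> c"
proof (induction M arbitrary: c)
  case Nil
  then show ?case by (simp add: height_def)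
next
  case (Cons s M)
  have *: "(\<forall>k\<le>length (s # M). height (take k (s # M)) \<ge> - int c) \<longleftrightarrow>
      (\<forall>k\<le>length M. step_height s + height (take k M) \<ge> - int c)"
    by (simp add: height_def All_less_Suc2 flip: less_Suc_eq_le)
  show ?case
  proof (cases s)
    case Up
    have "(\<forall>k\<le>length M. step_height s + height (take k M) \<ge> - int c) \<longleftrightarrow>
        (\<forall>k\<le>length M. height (take k M) \<ge> - int (Suc c))"
      by (auto simp: Up algebra_simps)
    then show ?thesis
      unfolding * using Cons[of "Suc c"] Up by auto
  next
    case Down
    show ?thesis
    proof (cases c)
      case 0
      have "\<not> (\<forall>k\<le>length M. step_height s + height (take k M) \<ge> - int c)"
        using 0 Down by (auto simp: height_def intro!: exI[of _ 0])
      then show ?thesis unfolding * using 0 Down by simp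
    next
      case (Suc c')
      have "(\<forall>k\<le>length M. step_height s + height (take k M) \<ge> - int c) \<longleftrightarrow>
          (\<forall>k\<le>length M. height (take k M) \<ge> - int c')"
        by (auto simp: Down Suc algebra_simps)
      then show ?thesis unfolding * using Cons[of c'] Down Suc by auto
    qed
  qed
qed

lemma dyck_path_iff: "dyck_path M \<longleftrightarrow> free_downs M = 0 \<and> free_ups M = 0"
  using free_downs_le_iff[of M 0] height_eq[of M] by (auto simp: dyck_path_def)

text \<open>
  Reflection in a vertical line, which carries statements about first unmatched down-steps over to
  last unmatched up-steps.
\<close>

fun flip :: "step \<Rightarrow> step" where
  "flip Up = Down"
| "flip Down = Up"

definition mirror :: "step list \<Rightarrow> step list" where
  "mirror M = rev (map flip M)"

lemma flip_flip [simp]: "flip (flip s) = s"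
  by (cases s) auto

lemma mirror_mirror [simp]: "mirror (mirror M) = M"
  by (simp add: mirror_def rev_map comp_def)

lemma free_mirror:
  shows free_downs_mirror: "free_downs (mirror M) = free_ups M"
    and free_ups_mirror: "free_ups (mirror M) = free_downs M"
proof -
  have "free_downs (mirror M) = free_ups M \<and> free_ups (mirror M) = free_downs M"
    by (induction M rule: free_downs.induct) (auto simp: mirror_def free_append)
  then show "free_downs (mirror M) = free_ups M" "free_ups (mirror M) = free_downs M" by auto
qed

lemma dyck_path_mirror: "dyck_path (mirror M) \<longleftrightarrow> dyck_path M"
  by (auto simp: dyck_path_iff free_mirror)

text \<open>
  This is the partner of an up-step written in front of \<open>M\<close>. When \<open>M\<close> itself begins with an up-step,
  its partner is found first; the remainder has one unmatched down-step less than the rest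
  of \<open>M\<close>, hence still at least one.
\<close>

lemma first_free_down_exists:
  "free_downs M > 0 \<Longrightarrow> \<exists>B C. M = B @ Down # C \<and> dyck_path B"
proof (induction M rule: length_induct)
  case (1 M)
  then obtain s N where M: "M = s # N" by (cases M) auto
  show ?case
  proof (cases s)
    case Down
    then show ?thesis using M by (intro exI[of _ "[]"] exI[of _ N]) (simp add: dyck_path_iff)
  next
    case Up
    with M 1 have "free_downs N > 0" by simp
    then obtain B C where BC: "N = B @ Down # C" "dyck_path B"
      using 1 M by auto
    have "free_downs C > 0"
      using 1(2) by (simp add: M Up BC(1) free_append BC(2)[unfolded dyck_path_iff])
    moreover have "length C < length M" by (simp add: M BC)
    ultimately obtain B' C' where "C = B' @ Down # C'" "dyck_path B'"
      using 1(1) by blast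
    then show ?thesis
      using BC by (intro exI[of _ "Up # B @ Down # B'"] exI[of _ C'])
        (simp add: M Up dyck_path_iff free_append)
  qed
qed

text \<open>
  If one of \<open>B\<close>, \<open>B'\<close> were a proper prefix of the other, then the longer one would continue the shorter one
  with a down-step, and so go below the axis.
\<close>

lemma first_free_down_unique:
  assumes "B @ Down # C = B' @ Down # C'" "dyck_path B" "dyck_path B'"
  shows "B = B'" "C = C'"
proof -
  have no_extension: "N = []" if "N @ L = Down # K" "dyck_path (A @ N)" "dyck_path A" for A N L K
    using that by (cases N) (auto simp: dyck_path_iff free_append)
  from assms(1) have "B = B' \<and> C = C'"
    unfolding append_eq_append_conv2
  proof (elim exE disjE)
    fix us assume us: "B = B' @ us \<and> us @ Down # C = Down # C'"
    then have "us = []" using no_extension[of us _ C' B'] assms by auto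
    with us show ?thesis by simp
  next
    fix us assume us: "B @ us = B' \<and> Down # C = us @ Down # C'"
    then have "us = []" using no_extension[of us "Down # C'" C B] assms by auto
    with us show ?thesis by simp
  qed
  then show "B = B'" "C = C'" by auto
qed

lemma last_free_up_exists:
  assumes "free_ups M > 0"
  shows "\<exists>A B. M = A @ Up # B \<and> dyck_path B"
proof -
  obtain B C where "mirror M = B @ Down # C" "dyck_path B"
    using first_free_down_exists[of "mirror M"] assms by (auto simp: free_mirror)
  then have "M = mirror C @ Up # mirror B" "dyck_path (mirror B)"
    using mirror_mirror[of M] dyck_path_mirror[of B] by (auto simp: mirror_def)
  then show ?thesis by blast
qed

lemma last_free_up_unique:
  assumes "A @ Up # B = A' @ Up # B'" "dyck_path B" "dyck_path B'"
  shows "A = A'" "B = B'"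
proof -
  have "mirror B @ Down # mirror A = mirror B' @ Down # mirror A'"
    using arg_cong[OF assms(1), of mirror] by (simp add: mirror_def)
  from first_free_down_unique[OF this] have "mirror A = mirror A'" "mirror B = mirror B'"
    using assms(2,3) by (auto simp: dyck_path_mirror)
  then show "A = A'" "B = B'" by (metis mirror_mirror)+
qed

section \<open>Tunnels and multitunnels under removal of an end step\<close>

lemma tunnels_Down_Cons: "tunnels (Down # M) = apfst ((#) Down) ` tunnels M"
  by (force simp: tunnels_def Cons_eq_append_conv)

lemma tunnels_Up_Cons:
  "tunnels (Up # M) = apfst ((#) Up) ` tunnels M \<union>
     {([] :: step list, B, C) | B C. M = B @ Down # C \<and> dyck_path B}"
  by (force simp: tunnels_def Cons_eq_append_conv)

lemma tunnels_snoc_cases: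
  assumes "(A, B, C) \<in> tunnels (M @ [s])"
  shows "(A, B, C) \<in> apsnd (apsnd (\<lambda>C. C @ [s])) ` tunnels M \<or>
    s = Down \<and> C = [] \<and> M = A @ Up # B \<and> dyck_path B"
proof (cases C rule: rev_cases)
  case Nil
  then have "M @ [s] = (A @ Up # B) @ [Down]" "dyck_path B"
    using assms by (auto simp: tunnels_def)
  then show ?thesis unfolding append1_eq_conv using Nil by simp
next
  case (snoc C' t)
  then have "M @ [s] = (A @ [Up] @ B @ [Down] @ C') @ [t]" "dyck_path B"
    using assms by (auto simp: tunnels_def)
  then have "(A, B, C') \<in> tunnels M" "C = C' @ [s]"
    unfolding append1_eq_conv tunnels_def using snoc by auto
  then show ?thesis by force
qed

lemma tunnels_snocI: "(A, B, C) \<in> tunnels M \<Longrightarrow> (A, B, C @ [s]) \<in> tunnels (M @ [s])"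
  by (simp add: tunnels_def)

lemma tunnels_snoc_Up: "tunnels (M @ [Up]) = apsnd (apsnd (\<lambda>C. C @ [Up])) ` tunnels M"
  by (auto intro: tunnels_snocI dest: tunnels_snoc_cases)

lemma tunnels_snoc_Down:
  "tunnels (M @ [Down]) = apsnd (apsnd (\<lambda>C. C @ [Down])) ` tunnels M \<union>
     {(A, B, [] :: step list) | A B. M = A @ Up # B \<and> dyck_path B}"
proof (intro equalityI subsetI)
  fix T assume "T \<in> tunnels (M @ [Down])"
  then show "T \<in> apsnd (apsnd (\<lambda>C. C @ [Down])) ` tunnels M \<union>
      {(A, B, [] :: step list) | A B. M = A @ Up # B \<and> dyck_path B}"
    by (cases T) (use tunnels_snoc_cases in blast)
qed (auto intro: tunnels_snocI, simp add: tunnels_def)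

lemma finite_paths_length_le: "finite {M :: step list. length M \<le> n}"
proof -
  have "(UNIV :: step set) \<subseteq> {Up, Down}" using step.exhaust by auto
  then have "finite (UNIV :: step set)" by (rule finite_subset) simp
  from finite_lists_length_le[OF this, of n] show ?thesis by simp
qed

lemma finite_tunnels: "finite (tunnels M)"
proof -
  let ?L = "{N :: step list. length N \<le> length M}"
  have "tunnels M \<subseteq> ?L \<times> ?L \<times> ?L" by (auto simp: tunnels_def)
  then show ?thesis by (rule finite_subset) (simp add: finite_paths_length_le)
qed

text \<open>
  The shift \<open>\<delta>\<close> is the number of steps already removed on the left minus the number removed on the
  right, so the center meant is that of the original path. Only the values \<open>0\<close> and \<open>1\<close> occur.
\<close>
definition multitunnels :: "nat \<Rightarrow> step list \<Rightarrow> (step list \<times> step list \<times> step list) set" where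
  "multitunnels \<delta> M =
     {(A, B, C). M = A @ B @ C \<and> dyck_path B \<and> B \<noteq> [] \<and> length A + \<delta> = length C}"

lemma finite_multitunnels: "finite (multitunnels \<delta> M)"
proof -
  let ?L = "{N :: step list. length N \<le> length M}"
  have "multitunnels \<delta> M \<subseteq> ?L \<times> ?L \<times> ?L" by (auto simp: multitunnels_def)
  then show ?thesis by (rule finite_subset) (simp add: finite_paths_length_le)
qed

lemma multitunnels_Cons:
  "multitunnels 0 (s # M) = apfst ((#) s) ` multitunnels (Suc 0) M \<union>
     (if dyck_path (s # M) then {([], s # M, [])} else {})"
  by (force simp: multitunnels_def Cons_eq_append_conv)

lemma card_multitunnels_Cons:
  "card (multitunnels 0 (s # M)) =
     card (multitunnels (Suc 0) M) + (if dyck_path (s # M) then 1 else 0)"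
proof -
  have "inj_on (apfst ((#) s)) (multitunnels (Suc 0) M)"
    by (auto intro!: inj_onI)
  from card_image[OF this] show ?thesis
    unfolding multitunnels_Cons
    by (subst card_Un_disjoint) (auto simp: finite_multitunnels)
qed

lemma card_multitunnels_snoc: "card (multitunnels (Suc 0) (M @ [s])) = card (multitunnels 0 M)"
proof -
  have "inj_on (apsnd (apsnd (\<lambda>C. C @ [s]))) (multitunnels 0 M)"
    by (auto intro!: inj_onI)
  moreover have "multitunnels (Suc 0) (M @ [s]) =
    apsnd (apsnd (\<lambda>C. C @ [s])) ` multitunnels 0 M" (is "?L = ?R")
  proof (intro equalityI subsetI)
    fix T assume T: "T \<in> ?L"
    obtain A B C where ABC: "T = (A, B, C)" by (cases T)
    show "T \<in> ?R"
    proof (cases C rule: rev_cases)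
      case Nil
      then show ?thesis using T ABC by (simp add: multitunnels_def)
    next
      case (snoc C' t)
      then have "M @ [s] = (A @ B @ C') @ [t]"
        using T ABC by (simp add: multitunnels_def)
      then have "T = (A, B, C' @ [s])" "(A, B, C') \<in> multitunnels 0 M"
        using T unfolding append1_eq_conv multitunnels_def ABC snoc by auto
      then show ?thesis by force
    qed
  qed (auto simp: multitunnels_def)
  ultimately show ?thesis by (simp add: card_image)
qed

section \<open>The weight of a word\<close>

context
  fixes x u v w :: "'a::field_char_0"
begin

definition tunnel_weight :: "nat \<Rightarrow> nat \<Rightarrow> 'a" where
  "tunnel_weight a c = (if a = c then x else if a < c then u else v)"

definition weight :: "nat \<Rightarrow> step list \<Rightarrow> 'a" where
  "weight \<delta> M = (\<Prod>(A, B, C)\<in>tunnels M. tunnel_weight (length A + \<delta>) (length C)) *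
     w ^ card (multitunnels \<delta> M)"

lemma weight_0_eq: "weight 0 D = x ^ ct D * u ^ lt D * v ^ rt D * w ^ cmt D"
proof -
  have count: "(\<Prod>(A, B, C)\<in>tunnels D. if S A C then k else 1) =
      k ^ card {(A, B, C) \<in> tunnels D. S A C}" for S and k :: 'a
  proof -
    have "(\<Prod>(A, B, C)\<in>tunnels D. if S A C then k else 1) =
        (\<Prod>T\<in>tunnels D. if (case T of (A, B, C) \<Rightarrow> S A C) then k else 1)"
      by (rule prod.cong) auto
    also have "\<dots> = (\<Prod>T\<in>{T \<in> tunnels D. case T of (A, B, C) \<Rightarrow> S A C}. k)"
      by (rule prod.inter_filter[symmetric, OF finite_tunnels])
    also have "{T \<in> tunnels D. case T of (A, B, C) \<Rightarrow> S A C} = {(A, B, C) \<in> tunnels D. S A C}"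
      by auto
    finally show ?thesis by simp
  qed
  have "(\<Prod>(A, B, C)\<in>tunnels D. tunnel_weight (length A) (length C)) =
      (\<Prod>(A, B, C)\<in>tunnels D. if length A = length C then x else 1) *
      (\<Prod>(A, B, C)\<in>tunnels D. if length A < length C then u else 1) *
      (\<Prod>(A, B, C)\<in>tunnels D. if length A > length C then v else 1)"
    unfolding prod.distrib[symmetric] by (rule prod.cong) (auto simp: tunnel_weight_def)
  then show ?thesis
    unfolding count by (simp add: weight_def ct_def lt_def rt_def cmt_def multitunnels_def)
qed

lemma prod_tunnels_shift_left:
  "(\<Prod>(A, B, C)\<in>apfst ((#) s) ` tunnels M. tunnel_weight (length A) (length C)) =
   (\<Prod>(A, B, C)\<in>tunnels M. tunnel_weight (Suc (length A)) (length C))"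
  by (subst prod.reindex) (auto intro!: inj_onI prod.cong)

lemma prod_tunnels_shift_right:
  "(\<Prod>(A, B, C)\<in>apsnd (apsnd (\<lambda>C. C @ [s])) ` tunnels M.
      tunnel_weight (Suc (length A)) (length C)) =
   (\<Prod>(A, B, C)\<in>tunnels M. tunnel_weight (length A) (length C))"
  by (subst prod.reindex) (auto intro!: inj_onI prod.cong simp: tunnel_weight_def)

lemma weight_Down_Cons: "weight 0 (Down # M) = weight (Suc 0) M"
  unfolding weight_def tunnels_Down_Cons card_multitunnels_Cons
  by (simp add: prod_tunnels_shift_left dyck_path_iff)

lemma weight_Up_Cons_free:
  assumes "free_downs M = 0"
  shows "weight 0 (Up # M) = weight (Suc 0) M"
proof -
  have "tunnels (Up # M) = apfst ((#) Up) ` tunnels M"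
    using assms unfolding tunnels_Up_Cons by (auto simp: free_append dyck_path_iff)
  then show ?thesis
    unfolding weight_def card_multitunnels_Cons using assms
    by (simp add: prod_tunnels_shift_left dyck_path_iff)
qed

text \<open>
  The new tunnel starts at the left end, so it is centered if \<open>C\<close> is empty, and left otherwise.
\<close>

lemma weight_Up_Cons_matched:
  assumes "M = B @ Down # C" "dyck_path B"
  shows "weight 0 (Up # M) =
    tunnel_weight 0 (length C) * (if dyck_path (Up # M) then w else 1) * weight (Suc 0) M"
proof -
  have "{([] :: step list, B', C') | B' C'. M = B' @ Down # C' \<and> dyck_path B'} = {([], B, C)}"
    using assms first_free_down_unique[of _ _ B C] by blast
  then have T: "tunnels (Up # M) = insert ([], B, C) (apfst ((#) Up) ` tunnels M)"
    unfolding tunnels_Up_Cons by simp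
  have "(\<Prod>(A, B, C)\<in>tunnels (Up # M). tunnel_weight (length A) (length C)) =
    tunnel_weight 0 (length C) * (\<Prod>(A, B, C)\<in>tunnels M. tunnel_weight (Suc (length A)) (length C))"
    unfolding T prod_tunnels_shift_left[of Up, symmetric]
    by (subst prod.insert) (auto simp: finite_tunnels)
  then show ?thesis
    unfolding weight_def card_multitunnels_Cons by simp
qed

text \<open>
  A word with shift \<open>1\<close> has lost one step at the left end of the original path, so a tunnel that
  ends with its last step is always a right one. For the same reason the word as a whole is no
  centered multitunnel, and \<open>w\<close> does not enter.
\<close>

lemma weight_snoc_Up: "weight (Suc 0) (M @ [Up]) = weight 0 M"
  unfolding weight_def tunnels_snoc_Up card_multitunnels_snoc
  by (simp add: prod_tunnels_shift_right)

lemma weight_snoc_Down: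
  "weight (Suc 0) (M @ [Down]) = (if free_ups M = 0 then 1 else v) * weight 0 M"
proof (cases "free_ups M = 0")
  case True
  then have "tunnels (M @ [Down]) = apsnd (apsnd (\<lambda>C. C @ [Down])) ` tunnels M"
    unfolding tunnels_snoc_Down by (auto simp: free_append dyck_path_iff)
  then show ?thesis
    unfolding weight_def card_multitunnels_snoc using True
    by (simp add: prod_tunnels_shift_right)
next
  case False
  then obtain A B where AB: "M = A @ Up # B" "dyck_path B"
    using last_free_up_exists[of M] by auto
  have "{(A', B', [] :: step list) | A' B'. M = A' @ Up # B' \<and> dyck_path B'} = {(A, B, [])}"
    using AB last_free_up_unique[of _ _ A B] by blast
  then have T: "tunnels (M @ [Down]) =
      insert (A, B, []) (apsnd (apsnd (\<lambda>C. C @ [Down])) ` tunnels M)"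
    unfolding tunnels_snoc_Down by simp
  have "(\<Prod>(A, B, C)\<in>tunnels (M @ [Down]). tunnel_weight (Suc (length A)) (length C)) =
    v * (\<Prod>(A, B, C)\<in>tunnels M. tunnel_weight (length A) (length C))"
    unfolding T prod_tunnels_shift_right[of Down, symmetric]
    by (subst prod.insert) (auto simp: finite_tunnels tunnel_weight_def)
  then show ?thesis
    unfolding weight_def card_multitunnels_snoc using False by simp
qed

lemma weight_Up_Cons_left:
  assumes "free_downs M > 0" "free_downs M + free_ups M > 1"
  shows "weight 0 (Up # M) = u * weight (Suc 0) M"
proof -
  obtain B C where BC: "M = B @ Down # C" "dyck_path B"
    using first_free_down_exists assms(1) by blast
  then have "C \<noteq> []"
    using assms(2) by (auto simp: free_append dyck_path_iff)
  moreover have "\<not> dyck_path (Up # M)"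
    using assms by (auto simp: dyck_path_iff)
  ultimately show ?thesis
    by (simp add: weight_Up_Cons_matched[OF BC] tunnel_weight_def)
qed

section \<open>Weight sums over words with given unmatched steps\<close>

definition paths :: "nat \<Rightarrow> nat \<Rightarrow> nat \<Rightarrow> step list set" where
  "paths m p q = {M. length M = m \<and> free_downs M = p \<and> free_ups M = q}"

definition total :: "nat \<Rightarrow> nat \<Rightarrow> nat \<Rightarrow> nat \<Rightarrow> 'a" where
  "total \<delta> m p q = (\<Sum>M\<in>paths m p q. weight \<delta> M)"

lemma finite_paths: "finite (paths m p q)"
  by (rule finite_subset[OF _ finite_paths_length_le[of m]]) (auto simp: paths_def)

lemma weight_Nil: "weight 0 [] = 1"
proof -
  have "tunnels [] = {}" "multitunnels 0 [] = {}"
    by (auto simp: tunnels_def multitunnels_def)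
  then show ?thesis by (simp add: weight_def)
qed

lemma total_0: "total 0 0 p q = (if p = 0 \<and> q = 0 then 1 else 0)"
proof -
  have "paths 0 p q = (if p = 0 \<and> q = 0 then {[]} else {})"
    by (auto simp: paths_def)
  then show ?thesis by (simp add: total_def weight_Nil)
qed

text \<open>
  The step split off is matched in the last of the three sets and unmatched in the other two.
  The same holds for the last step in the lemma after this one.
\<close>

lemma paths_Cons:
  "paths (Suc m) p q = {Down # M | M. length M = m \<and> Suc (free_downs M) = p \<and> free_ups M = q} \<union>
     {Up # M | M. length M = m \<and> free_downs M = 0 \<and> p = 0 \<and> Suc (free_ups M) = q} \<union>
     {Up # M | M. length M = m \<and> free_downs M = Suc p \<and> free_ups M = q}"
  (is "?L = ?R")
proof (intro equalityI subsetI)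
  fix M assume M: "M \<in> ?L"
  show "M \<in> ?R"
  proof (cases M rule: free_downs.cases)
    case (2 N)
    with M show ?thesis by (cases "free_downs N") (auto simp: paths_def)
  qed (use M in \<open>auto simp: paths_def\<close>)
qed (auto simp: paths_def)

lemma paths_snoc:
  "paths (Suc m) p q = {M @ [Up] | M. length M = m \<and> free_downs M = p \<and> Suc (free_ups M) = q} \<union>
     {M @ [Down] | M. length M = m \<and> free_ups M = 0 \<and> q = 0 \<and> Suc (free_downs M) = p} \<union>
     {M @ [Down] | M. length M = m \<and> free_downs M = p \<and> free_ups M = Suc q}"
  (is "?L = ?R")
proof (intro equalityI subsetI)
  fix M assume M: "M \<in> ?L"
  show "M \<in> ?R"
  proof (cases M rule: rev_cases)
    case (snoc N s)
    with M show ?thesis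
      by (cases s; cases "free_ups N") (auto simp: paths_def free_append)
  qed (use M in \<open>auto simp: paths_def\<close>)
qed (auto simp: paths_def free_append)

lemma sum_paths_Cons: "(\<Sum>M\<in>(#) s ` P. weight \<delta> M) = (\<Sum>M\<in>P. weight \<delta> (s # M))"
  by (subst sum.reindex) (auto intro!: inj_onI)

lemma sum_paths_snoc: "(\<Sum>M\<in>(\<lambda>M. M @ [s]) ` P. weight \<delta> M) = (\<Sum>M\<in>P. weight \<delta> (M @ [s]))"
  by (subst sum.reindex) (auto intro!: inj_onI)

text \<open>
  In the next four lemmas the first term belongs to an unmatched end step and the second one to an
  end step on a tunnel. The words \<open>M\<close> on the right have one unmatched step less and one more,
  respectively, with factors \<open>1\<close> and \<open>u\<close> at the left end and \<open>1\<close> and \<open>v\<close> at the right end. The case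
  split on \<open>p\<close> and \<open>q\<close> only tells which of \<open>p\<close> and \<open>q\<close> changes.
\<close>

lemma total_first_step_Suc:
  "total 0 (Suc m) (Suc p) q = total (Suc 0) m p q + u * total (Suc 0) m (Suc (Suc p)) q"
proof -
  have "paths (Suc m) (Suc p) q = (#) Down ` paths m p q \<union> (#) Up ` paths m (Suc (Suc p)) q"
    unfolding paths_Cons by (auto simp: paths_def)
  moreover have "(#) Down ` paths m p q \<inter> (#) Up ` paths m (Suc (Suc p)) q = {}"
    by auto
  ultimately have "total 0 (Suc m) (Suc p) q =
      (\<Sum>M\<in>paths m p q. weight 0 (Down # M)) + (\<Sum>M\<in>paths m (Suc (Suc p)) q. weight 0 (Up # M))"
    unfolding total_def by (simp add: sum.union_disjoint finite_paths sum_paths_Cons)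
  moreover have "(\<Sum>M\<in>paths m (Suc (Suc p)) q. weight 0 (Up # M)) =
      (\<Sum>M\<in>paths m (Suc (Suc p)) q. u * weight (Suc 0) M)"
    by (rule sum.cong) (auto simp: paths_def weight_Up_Cons_left)
  ultimately show ?thesis
    by (simp add: total_def weight_Down_Cons sum_distrib_left)
qed

lemma total_first_step_0:
  "total 0 (Suc m) 0 (Suc q) = total (Suc 0) m 0 q + u * total (Suc 0) m (Suc 0) (Suc q)"
proof -
  have "paths (Suc m) 0 (Suc q) = (#) Up ` paths m 0 q \<union> (#) Up ` paths m (Suc 0) (Suc q)"
    unfolding paths_Cons by (auto simp: paths_def)
  moreover have "(#) Up ` paths m 0 q \<inter> (#) Up ` paths m (Suc 0) (Suc q) = {}"
    by (auto simp: paths_def)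
  ultimately have "total 0 (Suc m) 0 (Suc q) =
      (\<Sum>M\<in>paths m 0 q. weight 0 (Up # M)) + (\<Sum>M\<in>paths m (Suc 0) (Suc q). weight 0 (Up # M))"
    unfolding total_def by (simp add: sum.union_disjoint finite_paths sum_paths_Cons)
  moreover have "(\<Sum>M\<in>paths m (Suc 0) (Suc q). weight 0 (Up # M)) =
      (\<Sum>M\<in>paths m (Suc 0) (Suc q). u * weight (Suc 0) M)"
    by (rule sum.cong) (auto simp: paths_def weight_Up_Cons_left)
  moreover have "(\<Sum>M\<in>paths m 0 q. weight 0 (Up # M)) = (\<Sum>M\<in>paths m 0 q. weight (Suc 0) M)"
    by (rule sum.cong) (auto simp: paths_def weight_Up_Cons_free)
  ultimately show ?thesis
    by (simp add: total_def sum_distrib_left)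
qed

lemma total_last_step_Suc:
  "total (Suc 0) (Suc m) p (Suc q) = total 0 m p q + v * total 0 m p (Suc (Suc q))"
proof -
  have "paths (Suc m) p (Suc q) =
      (\<lambda>M. M @ [Up]) ` paths m p q \<union> (\<lambda>M. M @ [Down]) ` paths m p (Suc (Suc q))"
    unfolding paths_snoc by (auto simp: paths_def)
  moreover have "(\<lambda>M. M @ [Up]) ` paths m p q \<inter> (\<lambda>M. M @ [Down]) ` paths m p (Suc (Suc q)) = {}"
    by auto
  ultimately have "total (Suc 0) (Suc m) p (Suc q) = (\<Sum>M\<in>paths m p q. weight (Suc 0) (M @ [Up])) +
      (\<Sum>M\<in>paths m p (Suc (Suc q)). weight (Suc 0) (M @ [Down]))"
    unfolding total_def by (simp add: sum.union_disjoint finite_paths sum_paths_snoc)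
  moreover have "(\<Sum>M\<in>paths m p (Suc (Suc q)). weight (Suc 0) (M @ [Down])) =
      (\<Sum>M\<in>paths m p (Suc (Suc q)). v * weight 0 M)"
    by (rule sum.cong) (auto simp: paths_def weight_snoc_Down)
  ultimately show ?thesis
    by (simp add: total_def weight_snoc_Up sum_distrib_left)
qed

lemma total_last_step_0:
  "total (Suc 0) (Suc m) (Suc p) 0 = total 0 m p 0 + v * total 0 m (Suc p) (Suc 0)"
proof -
  have "paths (Suc m) (Suc p) 0 =
      (\<lambda>M. M @ [Down]) ` paths m p 0 \<union> (\<lambda>M. M @ [Down]) ` paths m (Suc p) (Suc 0)"
    unfolding paths_snoc by (auto simp: paths_def)
  moreover have "(\<lambda>M. M @ [Down]) ` paths m p 0 \<inter> (\<lambda>M. M @ [Down]) ` paths m (Suc p) (Suc 0) = {}"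
    by (auto simp: paths_def)
  ultimately have "total (Suc 0) (Suc m) (Suc p) 0 =
      (\<Sum>M\<in>paths m p 0. weight (Suc 0) (M @ [Down])) +
      (\<Sum>M\<in>paths m (Suc p) (Suc 0). weight (Suc 0) (M @ [Down]))"
    unfolding total_def by (simp add: sum.union_disjoint finite_paths sum_paths_snoc)
  moreover have "(\<Sum>M\<in>paths m p 0. weight (Suc 0) (M @ [Down])) = (\<Sum>M\<in>paths m p 0. weight 0 M)"
    by (rule sum.cong) (auto simp: paths_def weight_snoc_Down)
  moreover have "(\<Sum>M\<in>paths m (Suc p) (Suc 0). weight (Suc 0) (M @ [Down])) =
      (\<Sum>M\<in>paths m (Suc p) (Suc 0). v * weight 0 M)"
    by (rule sum.cong) (auto simp: paths_def weight_snoc_Down)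
  ultimately show ?thesis by (simp add: total_def sum_distrib_left)
qed

text \<open>
  A nonempty Dyck path begins with an up-step and ends with a down-step. Either these two belong to one
  centered tunnel, and the word between them is a Dyck path, or they lie on a left tunnel and a
  right tunnel, and the word between them has one unmatched down-step and one unmatched up-step. In
  both cases the path itself is a centered multitunnel.
\<close>

lemma total_dyck:
  "total 0 (Suc (Suc m)) 0 0 =
     w * (x * total 0 m 0 0 + u * v * total 0 m (Suc 0) (Suc 0))"
proof -
  have 1: "paths (Suc (Suc m)) 0 0 = (#) Up ` paths (Suc m) (Suc 0) 0"
    unfolding paths_Cons[of "Suc m"] by (auto simp: paths_def)
  have 2: "paths (Suc m) (Suc 0) 0 =
      (\<lambda>M. M @ [Down]) ` paths m 0 0 \<union> (\<lambda>M. M @ [Down]) ` paths m (Suc 0) (Suc 0)"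
    unfolding paths_snoc by (auto simp: paths_def)
  have 3: "(\<lambda>M. M @ [Down]) ` paths m 0 0 \<inter> (\<lambda>M. M @ [Down]) ` paths m (Suc 0) (Suc 0) = {}"
    by (auto simp: paths_def)
  have "total 0 (Suc (Suc m)) 0 0 =
      (\<Sum>M\<in>(\<lambda>M. M @ [Down]) ` paths m 0 0. weight 0 (Up # M)) +
      (\<Sum>M\<in>(\<lambda>M. M @ [Down]) ` paths m (Suc 0) (Suc 0). weight 0 (Up # M))"
    unfolding total_def 1 sum_paths_Cons 2
    by (rule sum.union_disjoint) (use 3 in \<open>auto simp: finite_paths\<close>)
  also have "(\<Sum>M\<in>(\<lambda>M. M @ [Down]) ` paths m 0 0. weight 0 (Up # M)) =
      (\<Sum>M\<in>paths m 0 0. w * x * weight 0 M)"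
  proof (subst sum.reindex, goal_cases)
    case 2
    show ?case
    proof (rule sum.cong, goal_cases)
      case (2 M)
      then have M: "free_downs M = 0" "free_ups M = 0" by (auto simp: paths_def)
      then have "weight 0 (Up # (M @ [Down])) = x * w * weight (Suc 0) (M @ [Down])"
        by (subst weight_Up_Cons_matched[of _ M "[]"])
          (auto simp: dyck_path_iff free_append tunnel_weight_def)
      with M show ?case by (simp add: weight_snoc_Down)
    qed simp
  qed (auto intro: inj_onI)
  also have "(\<Sum>M\<in>(\<lambda>M. M @ [Down]) ` paths m (Suc 0) (Suc 0). weight 0 (Up # M)) =
      (\<Sum>M\<in>paths m (Suc 0) (Suc 0). w * u * v * weight 0 M)"
  proof (subst sum.reindex, goal_cases)
    case 2
    show ?case
    proof (rule sum.cong, goal_cases)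
      case (2 M)
      then have M: "free_downs M = 1" "free_ups M = 1" by (auto simp: paths_def)
      then obtain B C where BC: "M = B @ Down # C" "dyck_path B"
        using first_free_down_exists[of M] by auto
      have "weight 0 (Up # (M @ [Down])) =
          tunnel_weight 0 (length (C @ [Down])) * w * weight (Suc 0) (M @ [Down])"
        by (subst weight_Up_Cons_matched[of _ B "C @ [Down]"])
          (use M BC in \<open>auto simp: dyck_path_iff free_append\<close>)
      with M show ?case by (simp add: weight_snoc_Down tunnel_weight_def)
    qed simp
  qed (auto intro: inj_onI)
  finally show ?thesis
    by (simp add: total_def sum_distrib_left algebra_simps)
qed

end

lemma semilength_eq_half:
  assumes "dyck_path D"
  shows "length D = 2 * semilength D"
proof -
  have "even (length M + free_downs M + free_ups M)" for M
    by (induction M rule: free_downs.induct) (auto elim: oddE)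
  from this[of D] show ?thesis using assms by (simp add: dyck_path_iff semilength_def)
qed


section \<open>Solving the recursion\<close>

unbundle fps_syntax

text \<open>
  The recursion determines all sums, and the series \<open>R (z a b)\<^sup>j\<close> on even and \<open>a R (z a b)\<^sup>j\<close> on odd
  levels satisfy it: removal of a last step amounts to \<open>a = 1 + v z a b\<close>, removal of a first step to
  \<open>b = 1 + u z a b\<close>, and the Dyck paths to the equation for \<open>R\<close>. For a Dyck path of semilength
  \<open>n\<close> the removal of both end steps gives exactly the factor \<open>z\<close>.
\<close>

lemma total_eq_coefficients:
  fixes x u v w :: "'a::field_char_0" and a b R :: "'a fps"
  assumes a: "a = 1 + fps_const v * fps_X * a * b"
    and b: "b = 1 + fps_const u * fps_X * a * b"
    and R: "R = 1 + fps_const w * fps_X * (fps_const x * R + fps_const (u * v) * fps_X * a * b * R)"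
  shows "p + q = 2 * j \<Longrightarrow> total x u v w 0 (2 * n) p q = (R * (fps_X * a * b) ^ j) $ n"
proof (induction n arbitrary: p q j)
  case 0
  have "R $ 0 = 1" by (subst R) simp
  then show ?case using 0
    by (cases j) (auto simp: total_0 fps_mult_nth_0 fps_nth_power_0)
next
  case (Suc n)
  let ?A = "\<lambda>j. R * (fps_X * a * b) ^ j"
  \<comment> \<open>Words of odd length are those from which a step on the left has been removed.\<close>
  have odd: "total x u v w (Suc 0) (Suc (2 * n)) p q = (a * ?A j) $ n"
    if pq: "p + q = Suc (2 * j)" for p q j
  proof -
    have "a * ?A j = (1 + fps_const v * fps_X * a * b) * ?A j"
      using a by simp
    also have "\<dots> = ?A j + fps_const v * ?A (Suc j)"
      by (simp add: algebra_simps)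
    finally have step: "(a * ?A j) $ n = ?A j $ n + v * ?A (Suc j) $ n" by simp
    show ?thesis
    proof (cases q)
      case 0
      with pq obtain p' where "p = Suc p'" "p' = 2 * j" by (cases p) auto
      with 0 show ?thesis
        unfolding step by (simp add: total_last_step_0 Suc.IH[of _ _ j] Suc.IH[of _ _ "Suc j"])
    next
      case (Suc q')
      with pq show ?thesis
        unfolding step by (simp add: total_last_step_Suc Suc.IH[of _ _ j] Suc.IH[of _ _ "Suc j"])
    qed
  qed
  show ?case
  proof (cases j)
    case 0
    then have "p = 0" "q = 0" using Suc.prems by auto
    have "R = 1 + fps_X * (fps_const w * (fps_const x * ?A 0 + fps_const (u * v) * ?A 1))"
      by (subst R) (simp only: power_0 power_one_right mult_1_left mult_1_right mult_ac)
    also have "\<dots> $ Suc n = w * (x * ?A 0 $ n + u * v * ?A 1 $ n)"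
      by (simp add: fps_mult_fps_X_commute)
    finally have "R $ Suc n = w * (x * ?A 0 $ n + u * v * ?A 1 $ n)" .
    then show ?thesis
      using 0 \<open>p = 0\<close> \<open>q = 0\<close> by (simp add: total_dyck Suc.IH[of _ _ 0] Suc.IH[of _ _ 1])
  next
    case (Suc i)
    have "?A (Suc i) = fps_X * a * ?A i * b"
      by (simp add: algebra_simps)
    also have "\<dots> = fps_X * a * ?A i * (1 + fps_const u * fps_X * a * b)"
      using b by simp
    also have "\<dots> = fps_X * (a * ?A i + fps_const u * (a * ?A (Suc i)))"
      by (simp add: algebra_simps)
    finally have "?A (Suc i) $ Suc n =
        (fps_X * (a * ?A i + fps_const u * (a * ?A (Suc i)))) $ Suc n"
      by (rule arg_cong)
    also have "\<dots> = (a * ?A i) $ n + u * (a * ?A (Suc i)) $ n"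
      by simp
    finally have step: "?A (Suc i) $ Suc n = (a * ?A i) $ n + u * (a * ?A (Suc i)) $ n" .
    show ?thesis
    proof (cases p)
      case 0
      with Suc Suc.prems obtain q' where "q = Suc q'" "q' = Suc (2 * i)" by (cases q) auto
      with 0 show ?thesis
        unfolding Suc step by (simp add: total_first_step_0 odd[of _ _ i] odd[of _ _ "Suc i"])
    next
      case p: (Suc p')
      with Suc Suc.prems show ?thesis
        unfolding Suc step p by (simp add: total_first_step_Suc odd[of _ _ i] odd[of _ _ "Suc i"])
    qed
  qed
qed

text \<open>
  The equations for \<open>a\<close> and \<open>b\<close> give \<open>1 / b - 1 / a = (v - u) z\<close> and
  \<open>1 / (a b) = 1 / a - u z = 1 / b - v z\<close>, hence quadratic equations for \<open>1 / a\<close> and \<open>1 / b\<close> with the common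
  discriminant under the square root. Those solutions are chosen that have constant term \<open>1\<close>; they are
  \<open>1 / b = P / 2\<close> and \<open>1 / a = Q / 2\<close> in the proof. Also \<open>E\<close> is the denominator of \<open>R\<close>.
\<close>

lemma closed_form_solves_equations:
  fixes x u v w :: "'a::field_char_0"
  defines "S \<equiv> fps_sqrt (1 - 2 * fps_const (v + u) * fps_X + fps_const ((v - u)\<^sup>2) * fps_X\<^sup>2)"
  defines "R \<equiv> 2 / (2 - fps_const w + fps_const (v + u - 2 * x) * fps_const w * fps_X + fps_const w * S)"
  obtains a b where
    "a = 1 + fps_const v * fps_X * a * b"
    "b = 1 + fps_const u * fps_X * a * b"
    "R = 1 + fps_const w * fps_X * (fps_const x * R + fps_const (u * v) * fps_X * a * b * R)"
proof -
  have S0: "S $ 0 = 1" unfolding S_def by (rule fps_sqrt_nth_0)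
  have S2: "S ^ 2 = 1 - 2 * fps_const (v + u) * fps_X + fps_const ((v - u)\<^sup>2) * fps_X\<^sup>2"
    unfolding S_def by (rule fps_sqrt_power2) simp
  define U V W Z where "U = fps_const u" and "V = fps_const v" and "W = fps_const w" and "Z = (fps_X :: 'a fps)"
  have coeffs: "fps_const (v + u - 2 * x) = V + U - 2 * fps_const x" "fps_const (v + u) = V + U"
      "fps_const ((v - u)\<^sup>2) = (V - U)\<^sup>2" "fps_const w = W" "fps_X = Z"
    by (simp_all add: U_def V_def W_def Z_def numeral_fps_const power2_eq_square)
  define P where "P = 1 + (V - U) * Z + S"
  define Q where "Q = 1 + (U - V) * Z + S"
  define E where "E = 2 - W + (V + U - 2 * fps_const x) * W * Z + W * S"
  have nz: "P $ 0 \<noteq> 0" "Q $ 0 \<noteq> 0" "E $ 0 \<noteq> 0"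
    by (simp_all add: P_def Q_def E_def S0 U_def V_def W_def Z_def)
  define a where "a = 2 * inverse Q"
  define b where "b = 2 * inverse P"
  have aQ: "a * Q = 2" and bP: "b * P = 2"
    using nz by (simp_all add: a_def b_def mult.assoc inverse_mult_eq_1)
  have R: "R * E = 2"
  proof -
    have "R = 2 / E" unfolding R_def E_def coeffs ..
    then have "R = 2 * inverse E" using fps_divide_unit[OF nz(3)] by simp
    then show ?thesis using nz by (simp add: mult.assoc inverse_mult_eq_1)
  qed
  have S2': "S * S = 1 - 2 * (V + U) * Z + (V - U) * (V - U) * (Z * Z)"
    using S2 unfolding coeffs by (simp add: power2_eq_square mult.assoc)
  have PQ: "P * Q = 2 * (1 + S - (U + V) * Z)"
  proof -
    have "P * Q = 1 + 2 * S + S * S - (V - U) * (V - U) * (Z * Z)"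
      by (simp add: P_def Q_def algebra_simps)
    then show ?thesis by (simp add: S2' algebra_simps)
  qed
  have "P * Q \<noteq> 0" using nz by auto
  have two: "(2 :: 'a fps) \<noteq> 0" by (metis fps_numeral_nth_0 fps_zero_nth zero_neq_numeral)
  have ab: "Y * a * b * (P * Q) = 4 * Y" for Y
  proof -
    have "Y * a * b * (P * Q) = Y * (a * Q) * (b * P)" by (simp add: mult_ac)
    then show ?thesis unfolding aQ bP by simp
  qed
  have eq_a: "a = 1 + V * Z * a * b"
  proof -
    have "a * (P * Q) = 2 * P" using aQ by (simp add: mult_ac)
    also have "\<dots> = P * Q + 4 * (V * Z)" unfolding PQ by (simp add: P_def algebra_simps)
    also have "\<dots> = (1 + V * Z * a * b) * (P * Q)" by (simp only: distrib_right ab mult_1_left)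
    finally show ?thesis using \<open>P * Q \<noteq> 0\<close> by simp
  qed
  have eq_b: "b = 1 + U * Z * a * b"
  proof -
    have "b * (P * Q) = 2 * Q" using bP by (simp add: mult.assoc[symmetric])
    also have "\<dots> = P * Q + 4 * (U * Z)" unfolding PQ by (simp add: Q_def algebra_simps)
    also have "\<dots> = (1 + U * Z * a * b) * (P * Q)" by (simp only: distrib_right ab mult_1_left)
    finally show ?thesis using \<open>P * Q \<noteq> 0\<close> by simp
  qed
  \<comment> \<open>The equation for \<open>b\<close> reads \<open>1 / b = 1 - u z a\<close>; this makes the denominator linear in \<open>u z a\<close>.\<close>
  have UZa: "2 * (U * Z * a) = 2 - P"
  proof -
    have "2 = P * b" using bP by (simp add: mult.commute)
    also have "\<dots> = P * (1 + U * Z * a * b)" using eq_b by simp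
    also have "\<dots> = P + U * Z * a * (b * P)" by (simp add: algebra_simps)
    finally show ?thesis unfolding bP by (simp add: algebra_simps)
  qed
  have "2 * (1 + W * Z * (fps_const x * R + U * V * Z * a * b * R)) =
      2 + (2 * fps_const x * W * Z + 2 * U * Z * W * (V * Z * a * b)) * R"
    by (simp add: algebra_simps)
  also have "V * Z * a * b = a - 1" using eq_a by (simp add: algebra_simps)
  also have "2 * fps_const x * W * Z + 2 * U * Z * W * (a - 1) =
      2 * fps_const x * W * Z + W * (2 * (U * Z * a)) - 2 * U * W * Z"
    by (simp add: algebra_simps)
  also have "\<dots> = 2 - E" unfolding UZa by (simp add: E_def P_def algebra_simps)
  also have "2 + (2 - E) * R = 2 * R" using R by (simp add: algebra_simps)
  finally have eq_R: "R = 1 + W * Z * (fps_const x * R + U * V * Z * a * b * R)"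
    unfolding mult_left_cancel[OF two] by (rule sym)
  show ?thesis
    by (rule that[of a b]) (use eq_a eq_b eq_R in \<open>simp_all add: U_def V_def W_def Z_def\<close>)
qed

text \<open>
  Only Dyck paths of semilength \<open>n\<close> contribute to the coefficient of \<open>z\<^sup>n\<close>; there are finitely
  many, and they are the words of length \<open>2 n\<close> with \<open>p = q = 0\<close>.
\<close>

theorem theorem3:
  fixes x u v w :: "'a::field_char_0"
  shows "((\<lambda>D. fps_const (x ^ ct D * u ^ lt D * v ^ rt D * w ^ cmt D) * fps_X ^ semilength D) has_sum
      2 / (2 - fps_const w + fps_const (v + u - 2 * x) * fps_const w * fps_X
           + fps_const w * fps_sqrt (1 - 2 * fps_const (v + u) * fps_X
                                       + fps_const ((v - u)\<^sup>2) * fps_X\<^sup>2)))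
    {D. dyck_path D}"
    (is "(?F has_sum ?R) _")
proof (rule has_sum_fpsI)
  have nth: "?F D $ n = (if semilength D = n then weight x u v w 0 D else 0)" for D n
    by (simp add: weight_0_eq)
  have paths: "paths (2 * n) 0 0 = {D. dyck_path D \<and> semilength D = n}" for n
    using semilength_eq_half by (auto simp: paths_def dyck_path_iff semilength_def)
  have sub: "{D \<in> {D. dyck_path D}. ?F D $ n \<noteq> 0} \<subseteq> paths (2 * n) 0 0" for n
    unfolding paths nth by auto
  show "finite {D \<in> {D. dyck_path D}. ?F D $ n \<noteq> 0}" for n
    using sub finite_paths by (rule finite_subset)
  fix n
  obtain a b where
    "a = 1 + fps_const v * fps_X * a * b"
    "b = 1 + fps_const u * fps_X * a * b"
    "?R = 1 + fps_const w * fps_X * (fps_const x * ?R + fps_const (u * v) * fps_X * a * b * ?R)"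
    by (rule closed_form_solves_equations)
  from total_eq_coefficients[OF this, of 0 0 0 n]
  have "?R $ n = total x u v w 0 (2 * n) 0 0" by simp
  also have "\<dots> = (\<Sum>D\<in>paths (2 * n) 0 0. ?F D $ n)"
    unfolding total_def nth by (rule sum.cong) (auto simp: paths)
  also have "\<dots> = (\<Sum>D | D \<in> {D. dyck_path D} \<and> ?F D $ n \<noteq> 0. ?F D $ n)"
    using finite_paths sub[of n] by (rule sum.mono_neutral_right) (auto simp: paths)
  finally show "?R $ n = (\<Sum>D | D \<in> {D. dyck_path D} \<and> ?F D $ n \<noteq> 0. ?F D $ n)" .
qed

end
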